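(* Let $k, n, r, s, t$ be nonnegative integers with $k \geq 1$, $n \geq 6$ and $r + s + t = k$. Then $$ gr_{k}(K_{3} : rW_{n}, sC_{n - 1}, tP_{n - 2}) \leq (n - 4)^{2} \cdot 30^{r} \cdot 10^{s} \cdot 2^{t} + k(n - 1). $$
   Context: For $n \geq 4$, the wheel $W_n = K_1 \vee C_{n-1}$ is a cycle on $n-1$ vertices together with one additional vertex adjacent to all cycle vertices; $C_{m}$ is the cycle on $m$ vertices and $P_{m}$ is the path on $m$ vertices. For nonnegative integers $k,n,r,s,t$ with $k\ge 1$, $n \geq 6$ and $r+s+t=k$, $gr_{k}(K_{3} : rW_{n}, sC_{n - 1}, tP_{n - 2})$ denotes the minimum integer $N$ such that every coloring of the edges of $K_N$ with colors $1,\dots,k$ contains one of: a rainbow triangle (three edges of distinct colors), a monochromatic copy of $W_n$ in one of the colors $1,\dots,r$, a monochromatic copy of $C_{n-1}$ in one of the colors $r+1,\dots,r+s$, or a monochromatic copy of $P_{n-2}$ in one of the colors $r+s+1,\dots,k$. *)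

theory Defs
  imports Main "HOL-Library.Ramsey"
begin

text \<open>Finite simple graphs are pairs of a vertex set and a set of two-element vertex sets.\<close>

type_synonym 'a graph = "'a set \<times> 'a set set"

definition complete_graph :: "nat \<Rightarrow> nat graph" where
  "complete_graph m = ({..<m}, nsets {..<m} 2)"

text \<open>Only meaningful for \<open>m \<ge> 3\<close>.\<close>

definition cycle_graph :: "nat \<Rightarrow> nat graph" where
  "cycle_graph m = ({..<m}, {{i, Suc i mod m} | i. i < m})"

definition path_graph :: "nat \<Rightarrow> nat graph" where
  "path_graph m = ({..<m}, {{i, Suc i} | i. Suc i < m})"

definition graph_join :: "'a graph \<Rightarrow> 'b graph \<Rightarrow> ('a + 'b) graph" where
  "graph_join G H =
    (fst G <+> fst H,
     (\<lambda>e. Inl ` e) ` snd G \<union> (\<lambda>e. Inr ` e) ` snd H \<union>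
       {{Inl x, Inr y} | x y. x \<in> fst G \<and> y \<in> fst H})"

definition wheel_graph :: "nat \<Rightarrow> (nat + nat) graph" where
  "wheel_graph n = graph_join (complete_graph 1) (cycle_graph (n - 1))"

definition edge_coloring :: "nat \<Rightarrow> nat \<Rightarrow> (nat set \<Rightarrow> nat) \<Rightarrow> bool" where
  "edge_coloring k N c \<longleftrightarrow> (\<forall>e \<in> snd (complete_graph N). c e \<in> {1..k})"

definition has_rainbow_triangle :: "nat \<Rightarrow> (nat set \<Rightarrow> nat) \<Rightarrow> bool" where
  "has_rainbow_triangle N c \<longleftrightarrow>
    (\<exists>x y z. {x, y, z} \<subseteq> fst (complete_graph N) \<and> distinct [x, y, z] \<and>
       distinct [c {x, y}, c {y, z}, c {x, z}])"

text \<open>A copy is a not necessarily induced subgraph.\<close>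

definition has_mono_copy :: "nat \<Rightarrow> (nat set \<Rightarrow> nat) \<Rightarrow> 'a graph \<Rightarrow> nat \<Rightarrow> bool" where
  "has_mono_copy N c H i \<longleftrightarrow>
    (\<exists>f. inj_on f (fst H) \<and> f ` fst H \<subseteq> fst (complete_graph N) \<and>
       (\<forall>e \<in> snd H. c (f ` e) = i))"

definition gr_property :: "nat \<Rightarrow> nat \<Rightarrow> nat \<Rightarrow> nat \<Rightarrow> nat \<Rightarrow> nat \<Rightarrow> bool" where
  "gr_property k n r s t N \<longleftrightarrow>
    (\<forall>c. edge_coloring k N c \<longrightarrow>
       has_rainbow_triangle N c \<or>
       (\<exists>i \<in> {1..r}. has_mono_copy N c (wheel_graph n) i) \<or>
       (\<exists>i \<in> {r + 1..r + s}. has_mono_copy N c (cycle_graph (n - 1)) i) \<or>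
       (\<exists>i \<in> {r + s + 1..k}. has_mono_copy N c (path_graph (n - 2)) i))"

text \<open>
  The Gallai--Ramsey number \<open>gr\<^sub>k(K\<^sub>3 : r W\<^sub>n, s C\<^sub>n\<^sub>-\<^sub>1, t P\<^sub>n\<^sub>-\<^sub>2)\<close>, intended for \<open>k = r + s + t\<close>.
  The number \<open>t\<close> of colors for paths enters only through \<open>k\<close>.
  If no \<open>N\<close> had the property, the value would be unspecified, so an upper bound on
  it can only be proved by exhibiting some such \<open>N\<close>.
\<close>

definition gallai_ramsey_number :: "nat \<Rightarrow> nat \<Rightarrow> nat \<Rightarrow> nat \<Rightarrow> nat \<Rightarrow> nat" where
  "gallai_ramsey_number k n r s t = (LEAST N. gr_property k n r s t N)"

end

theory Submission
  imports Defs
begin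

text \<open>
  Put \<open>m = n - 2\<close>. A vertex joined in color \<open>i\<close> to all of a set \<open>V\<close> turns a cycle of color \<open>i\<close>
  in \<open>V\<close> into a wheel, and a path on \<open>m\<close> vertices into a cycle on \<open>m + 1\<close>. So passing to \<open>V\<close>
  lowers the forbidden graph of color \<open>i\<close> from wheel to cycle or from cycle to path, which divides
  the product of the weights 30, 10, 2 by at least 3. A path color cannot be lowered, but the
  set \<open>T\<^sub>i\<close> of the vertices outside that are joined to \<open>V\<close> in such a color \<open>i\<close> has fewer than \<open>m\<close>
  elements as long as \<open>V\<close> has at least \<open>m\<close>. Hence the bound to prove by induction is
  \<open>|A| \<le> (m - 2)\<^sup>2 \<cdot> (product of weights) + (sum of m - |T\<^sub>i|)\<close>.

  For the induction step take a Gallai partition of \<open>A\<close> with colors \<open>a\<close> and \<open>b\<close> between the parts,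
  a part \<open>V\<close>, and the sets \<open>R\<close> and \<open>B\<close> of the vertices joined to \<open>V\<close> in color \<open>a\<close> and \<open>b\<close>. If
  neither color is a path color, \<open>V\<close>, \<open>R\<close> and \<open>B\<close> all have a lowered color. If only \<open>b\<close> is, choose
  \<open>V\<close> to contain a vertex of degree at most \<open>m - 2\<close> in color \<open>b\<close>, so that \<open>B\<close> is small. If both
  are, either some part has at least \<open>m\<close> vertices, and \<open>R\<close> and \<open>B\<close> are moved to \<open>T\<^sub>a\<close> and \<open>T\<^sub>b\<close>, or
  all parts are small, and \<open>A\<close> itself has at most \<open>4 (m - 2)\<^sup>2\<close> vertices.
\<close>

section \<open>Targets, weights and the numerical estimates\<close>

datatype target = Wheel | Cycle | Path

fun weight :: "target \<Rightarrow> nat" where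
  "weight Wheel = 30"
| "weight Cycle = 10"
| "weight Path = 2"

fun lower :: "target \<Rightarrow> target" where
  "lower Wheel = Cycle"
| "lower _ = Path"

text \<open>With \<open>m = n - 2\<close> the factor \<open>(m - 2)\<^sup>2\<close> is the
  \<open>(n - 4)\<^sup>2\<close> of the theorem.\<close>

definition target_bound :: "nat set \<Rightarrow> nat \<Rightarrow> (nat \<Rightarrow> target) \<Rightarrow> nat" where
  "target_bound K m \<sigma> = (m - 2)\<^sup>2 * (\<Prod>i\<in>K. weight (\<sigma> i))"

text \<open>The room left in the sets \<open>T i\<close>. The subtraction is truncated, so it counts
  exactly only while \<open>card (T i) \<le> m\<close>; hence the hypothesis on
  \<open>card S\<close> in \<open>slack_update\<close>.\<close>

definition slack :: "nat set \<Rightarrow> nat \<Rightarrow> (nat \<Rightarrow> 'a set) \<Rightarrow> nat" where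
  "slack K m T = (\<Sum>i\<in>K. m - card (T i))"

lemma weight_ge_2: "weight s \<ge> 2"
  by (cases s) auto

lemma weight_ge_10: "s \<noteq> Path \<Longrightarrow> weight s \<ge> 10"
  by (cases s) auto

text \<open>Only the factor of color \<open>i\<close> changes, from 30 to 10 or from 10 to
  2.\<close>

lemma target_bound_lower:
  assumes "finite K" "i \<in> K" "\<sigma> i \<noteq> Path"
  shows "3 * target_bound K m (\<sigma>(i := lower (\<sigma> i))) \<le> target_bound K m \<sigma>"
proof -
  let ?Q = "\<Prod>j\<in>K - {i}. weight (\<sigma> j)"
  have "(\<Prod>j\<in>K. weight ((\<sigma>(i := lower (\<sigma> i))) j)) = weight (lower (\<sigma> i)) * ?Q"
    using assms(1,2) by (simp add: prod.remove[of K i])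
  moreover have "(\<Prod>j\<in>K. weight (\<sigma> j)) = weight (\<sigma> i) * ?Q"
    using assms(1,2) by (simp add: prod.remove[of K i])
  moreover have "3 * weight (lower (\<sigma> i)) \<le> weight (\<sigma> i)"
    using assms(3) by (cases "\<sigma> i") auto
  then have "3 * (weight (lower (\<sigma> i)) * ?Q) \<le> weight (\<sigma> i) * ?Q"
    by (metis mult.assoc mult_le_mono1)
  then have "(m - 2)\<^sup>2 * (3 * (weight (lower (\<sigma> i)) * ?Q)) \<le> (m - 2)\<^sup>2 * (weight (\<sigma> i) * ?Q)"
    by (rule mult_le_mono2)
  ultimately show ?thesis by (simp add: target_bound_def)
qed

text \<open>Outside \<open>J\<close> every weight is replaced by its least value 2; \<open>J\<close>
  holds the colors about which more is known.\<close>

lemma target_bound_ge: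
  assumes "finite K" "J \<subseteq> K"
  shows "(m - 2)\<^sup>2 * ((\<Prod>i\<in>J. weight (\<sigma> i)) * 2 ^ (card K - card J)) \<le> target_bound K m \<sigma>"
proof -
  have "card K - card J = card (K - J)"
    using assms by (simp add: card_Diff_subset finite_subset)
  moreover have "2 ^ card (K - J) \<le> (\<Prod>i\<in>K - J. weight (\<sigma> i))"
    using prod_mono[of "K - J" "\<lambda>_. 2" "\<lambda>i. weight (\<sigma> i)"] weight_ge_2 by simp
  moreover have "(\<Prod>i\<in>K. weight (\<sigma> i)) = (\<Prod>i\<in>J. weight (\<sigma> i)) * (\<Prod>i\<in>K - J. weight (\<sigma> i))"
    using assms by (metis prod.subset_diff mult.commute)
  ultimately show ?thesis by (simp add: target_bound_def mult_le_mono)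
qed

lemma slack_le: "slack K m T \<le> card K * m"
proof -
  have "slack K m T \<le> (\<Sum>i\<in>K. m)" unfolding slack_def by (intro sum_mono) simp
  then show ?thesis by simp
qed

lemma slack_update:
  assumes "finite K" "i \<in> K" "card S = card (T i) + d" "card S \<le> m"
  shows "slack K m (T(i := S)) + d = slack K m T"
proof -
  have "slack K m (T(i := S)) = (m - card S) + (\<Sum>j\<in>K - {i}. m - card (T j))"
    using assms(1,2) by (simp add: slack_def sum.remove[of K i])
  moreover have "slack K m T = (m - card (T i)) + (\<Sum>j\<in>K - {i}. m - card (T j))"
    using assms(1,2) by (simp add: slack_def sum.remove[of K i])
  ultimately show ?thesis using assms(3,4) by simp
qed

lemma le_two_power_pred: "n \<le> 2 ^ (n - 1)" for n :: nat
  by (cases n) (simp_all add: Suc_leI less_exp)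

text \<open>The slack is linear in \<open>card K\<close> while the product is at least
  \<open>10 * 2 ^ (card K - 1)\<close>, which leaves
  \<open>3 * (m + (m - 2)) \<le> 10 * (m - 2)\<^sup>2\<close>. The left side is what two sets with a
  lowered color and at most \<open>m - 2\<close> further vertices require: two thirds of the bound,
  twice the slack and \<open>m - 2\<close> must stay below the bound plus one slack.\<close>

lemma target_bound_one_nonpath:
  assumes "finite K" "i \<in> K" "\<sigma> i \<noteq> Path" "m \<ge> 4"
  shows "3 * slack K m T + 3 * (m - 2) \<le> target_bound K m \<sigma>"
proof -
  define e :: nat where "e = 2 ^ (card K - 1)"
  obtain d where d: "m = d + 4" using assms(4) by (metis add.commute le_iff_add)
  have "e \<ge> 1" by (simp add: e_def)
  have "slack K m T \<le> e * m"
    using slack_le[of K m T] le_two_power_pred[of "card K"] unfolding e_def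
    by (meson le_trans mult_le_mono1)
  moreover have "m - 2 \<le> e * (m - 2)" using \<open>e \<ge> 1\<close> by simp
  ultimately have "3 * slack K m T + 3 * (m - 2) \<le> e * (3 * (m + (m - 2)))"
    by (simp add: algebra_simps)
  also have "\<dots> \<le> e * (10 * (m - 2)\<^sup>2)"
    by (rule mult_le_mono2) (simp add: d power2_eq_square algebra_simps)
  also have "\<dots> \<le> (m - 2)\<^sup>2 * (weight (\<sigma> i) * e)"
    using weight_ge_10[OF assms(3)] by simp
  also have "\<dots> \<le> target_bound K m \<sigma>"
    using target_bound_ge[of K "{i}" m \<sigma>] assms by (simp add: e_def)
  finally show ?thesis .
qed

text \<open>The factor 9 comes from 1/9 + 1/3 + 1/3 = 7/9: three sets with these shares of the bound
  and one slack each fit as soon as twice the slack is at most 2/9 of the bound.\<close>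

lemma target_bound_two_nonpath:
  assumes "finite K" "i \<in> K" "j \<in> K" "i \<noteq> j" "\<sigma> i \<noteq> Path" "\<sigma> j \<noteq> Path" "m \<ge> 4"
  shows "9 * slack K m T \<le> target_bound K m \<sigma>"
proof -
  define e :: nat where "e = 2 ^ (card K - 2)"
  obtain d where d: "m = d + 4" using assms(7) by (metis add.commute le_iff_add)
  have "card {i, j} \<le> card K" using assms by (intro card_mono) auto
  then have "card K \<ge> 2" using assms(4) by simp
  then have "card K - 1 = Suc (card K - 2)" by simp
  then have "card K \<le> 2 * e"
    using le_two_power_pred[of "card K"] by (simp add: e_def)
  then have "slack K m T \<le> 2 * e * m"
    using slack_le[of K m T] by (meson le_trans mult_le_mono1)
  then have "9 * slack K m T \<le> e * (18 * m)" by simp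
  also have "\<dots> \<le> e * (100 * (m - 2)\<^sup>2)"
    by (rule mult_le_mono2) (simp add: d power2_eq_square algebra_simps)
  also have "\<dots> = (m - 2)\<^sup>2 * (10 * 10 * e)" by simp
  also have "\<dots> \<le> (m - 2)\<^sup>2 * (weight (\<sigma> i) * weight (\<sigma> j) * e)"
    using weight_ge_10[OF assms(5)] weight_ge_10[OF assms(6)]
    by (intro mult_le_mono mult_le_mono1 le_refl)
  also have "\<dots> \<le> target_bound K m \<sigma>"
    using target_bound_ge[of K "{i, j}" m \<sigma>] assms by (simp add: e_def numeral_2_eq_2)
  finally show ?thesis .
qed

lemma target_bound_ge_one:
  assumes "finite K" "i \<in> K"
  shows "2 * (m - 2)\<^sup>2 \<le> target_bound K m \<sigma>"
proof -
  have "2 * 1 \<le> weight (\<sigma> i) * 2 ^ (card K - 1)"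
    by (intro mult_le_mono weight_ge_2) simp
  then have "(m - 2)\<^sup>2 * (2 * 1) \<le> (m - 2)\<^sup>2 * (weight (\<sigma> i) * 2 ^ (card K - 1))"
    by (rule mult_le_mono2)
  also have "\<dots> \<le> target_bound K m \<sigma>"
    using target_bound_ge[of K "{i}" m \<sigma>] assms by simp
  finally show ?thesis by simp
qed

lemma target_bound_ge_two:
  assumes "finite K" "i \<in> K" "j \<in> K" "i \<noteq> j"
  shows "4 * (m - 2)\<^sup>2 \<le> target_bound K m \<sigma>"
proof -
  have "2 * 2 * 1 \<le> weight (\<sigma> i) * weight (\<sigma> j) * 2 ^ (card K - 2)"
    by (intro mult_le_mono weight_ge_2) simp
  then have "(m - 2)\<^sup>2 * (2 * 2 * 1) \<le>
      (m - 2)\<^sup>2 * (weight (\<sigma> i) * weight (\<sigma> j) * 2 ^ (card K - 2))"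
    by (rule mult_le_mono2)
  also have "\<dots> \<le> target_bound K m \<sigma>"
    using target_bound_ge[of K "{i, j}" m \<sigma>] assms by (simp add: numeral_2_eq_2)
  finally show ?thesis by simp
qed

section \<open>Gallai colorings and the connected components of a single color\<close>

locale symmetric_coloring =
  fixes col :: "'a \<Rightarrow> 'a \<Rightarrow> nat"
  assumes col_sym: "col x y = col y x"
begin

definition gallai_on :: "'a set \<Rightarrow> bool" where
  "gallai_on A \<longleftrightarrow> (\<forall>x\<in>A. \<forall>y\<in>A. \<forall>z\<in>A. x \<noteq> y \<longrightarrow> y \<noteq> z \<longrightarrow> x \<noteq> z \<longrightarrow>
     col x y = col y z \<or> col y z = col x z \<or> col x y = col x z)"

definition color_edges :: "nat \<Rightarrow> 'a set \<Rightarrow> ('a \<times> 'a) set" where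
  "color_edges i A = {(x, y). x \<in> A \<and> y \<in> A \<and> x \<noteq> y \<and> col x y = i}"

definition color_connected :: "nat \<Rightarrow> 'a set \<Rightarrow> bool" where
  "color_connected i A \<longleftrightarrow> (\<forall>x\<in>A. \<forall>y\<in>A. (x, y) \<in> (color_edges i A)\<^sup>*)"

lemma gallai_on_subset: "gallai_on A \<Longrightarrow> B \<subseteq> A \<Longrightarrow> gallai_on B"
  unfolding gallai_on_def by blast

lemma gallai_onD:
  "gallai_on A \<Longrightarrow> x \<in> A \<Longrightarrow> y \<in> A \<Longrightarrow> z \<in> A \<Longrightarrow> x \<noteq> y \<Longrightarrow> y \<noteq> z \<Longrightarrow> x \<noteq> z \<Longrightarrow>
     col x y = col y z \<or> col y z = col x z \<or> col x y = col x z"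
  unfolding gallai_on_def by blast

lemma sym_color_edges: "sym (color_edges i A)"
  by (auto simp: sym_def color_edges_def col_sym)

lemma color_reach_sym: "(x, y) \<in> (color_edges i A)\<^sup>* \<Longrightarrow> (y, x) \<in> (color_edges i A)\<^sup>*"
  by (meson symD sym_rtrancl sym_color_edges)

lemma color_reach_in: "(x, y) \<in> (color_edges i A)\<^sup>* \<Longrightarrow> x \<in> A \<Longrightarrow> y \<in> A"
  by (induction rule: rtrancl_induct) (auto simp: color_edges_def)

text \<open>Along an edge \<open>u v\<close> of color \<open>i\<close> in the component of
  \<open>x\<close>, neither \<open>u y\<close> nor \<open>v y\<close> has color \<open>i\<close>, so
  the triangle \<open>u v y\<close> forces these two colors to agree.\<close>

lemma component_homogeneous:
  assumes "gallai_on A" "x \<in> A" "y \<in> A" "(x, x') \<in> (color_edges i A)\<^sup>*"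
    and "(x, y) \<notin> (color_edges i A)\<^sup>*"
  shows "col x y = col x' y"
  using assms(4)
proof (induction rule: rtrancl_induct)
  case base
  show ?case ..
next
  case (step u v)
  have uv: "u \<in> A" "v \<in> A" "u \<noteq> v" "col u v = i"
    using step.hyps by (auto simp: color_edges_def)
  have nu: "(u, y) \<notin> color_edges i A" and nv: "(v, y) \<notin> color_edges i A"
    and "u \<noteq> y" "v \<noteq> y"
    using assms(5) step.hyps by (auto intro: rtrancl.rtrancl_into_rtrancl)
  then have "col u y \<noteq> i" "col v y \<noteq> i"
    using uv assms(3) by (auto simp: color_edges_def)
  then have "col u y = col v y"
    using gallai_onD[OF assms(1), of u v y] uv assms(3) \<open>u \<noteq> y\<close> \<open>v \<noteq> y\<close> by auto
  then show ?case using step.IH by simp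
qed

lemma color_connected_edge:
  assumes "color_connected i A" "v \<in> A" "w \<in> A" "w \<noteq> v"
  obtains u where "u \<in> A" "u \<noteq> v" "col v u = i"
proof -
  have "(v, w) \<in> (color_edges i A)\<^sup>*" using assms by (auto simp: color_connected_def)
  then obtain u where "(v, u) \<in> color_edges i A"
    using assms(4) by (metis converse_rtranclE)
  then show thesis using that[of u] by (auto simp: color_edges_def)
qed

text \<open>A walk of color \<open>i\<close> from \<open>y\<close> to \<open>v\<close> reaches
  \<open>v\<close> for the first time from a neighbor that still lies in the component of
  \<open>y\<close> without \<open>v\<close>.\<close>

lemma component_of_deleted_vertex:
  assumes "color_connected i A" "v \<in> A" "y \<in> A - {v}"
  obtains y' where "(y, y') \<in> (color_edges i (A - {v}))\<^sup>*" "col v y' = i" "y' \<in> A - {v}"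
proof -
  \<comment> \<open>Invariant along the walk: either it has avoided \<open>v\<close> so far, or the
    wanted neighbor has already been met.\<close>
  have reach: "(y, z) \<in> (color_edges i (A - {v}))\<^sup>* \<or>
    (\<exists>y'. (y, y') \<in> (color_edges i (A - {v}))\<^sup>* \<and> col v y' = i)"
    if "(y, z) \<in> (color_edges i A)\<^sup>*" for z
    using that
  proof (induction rule: rtrancl_induct)
    case base
    show ?case by blast
  next
    case (step u w)
    then consider "(y, u) \<in> (color_edges i (A - {v}))\<^sup>*"
      | "\<exists>y'. (y, y') \<in> (color_edges i (A - {v}))\<^sup>* \<and> col v y' = i" by blast
    then show ?case
    proof cases
      case 1
      then have "u \<in> A - {v}" using color_reach_in assms(3) by metis
      moreover have "w \<in> A" "u \<noteq> w" "col u w = i"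
        using step.hyps by (auto simp: color_edges_def)
      ultimately show ?thesis
      proof (cases "w = v")
        case True
        then show ?thesis using 1 \<open>col u w = i\<close> col_sym by metis
      next
        case False
        then have "(u, w) \<in> color_edges i (A - {v})"
          using \<open>u \<in> A - {v}\<close> \<open>w \<in> A\<close> \<open>u \<noteq> w\<close> \<open>col u w = i\<close> by (auto simp: color_edges_def)
        then show ?thesis using 1 by (meson rtrancl.rtrancl_into_rtrancl)
      qed
    qed blast
  qed
  have "(y, v) \<in> (color_edges i A)\<^sup>*" using assms by (auto simp: color_connected_def)
  moreover have "(y, v) \<notin> (color_edges i (A - {v}))\<^sup>*"
    using color_reach_in[of y v i "A - {v}"] assms(3) by auto
  ultimately obtain y' where "(y, y') \<in> (color_edges i (A - {v}))\<^sup>*" "col v y' = i"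
    using reach by blast
  then show thesis using that color_reach_in assms(3) by metis
qed

text \<open>The component of \<open>y\<close> contains some \<open>y'\<close> with
  \<open>v y'\<close> of color \<open>i\<close>. In the triangle \<open>v w y'\<close> the edge
  \<open>v w\<close> has color \<open>j\<close> and \<open>w y'\<close> does not have color
  \<open>i\<close>, so \<open>w y'\<close> has color \<open>j\<close>. Homogeneity of the two
  components carries this over to \<open>x y\<close>.\<close>

lemma deleted_component_color:
  assumes "gallai_on A" "v \<in> A" "color_connected i A" "j \<noteq> i"
    and w: "w \<in> A - {v}" "col v w = j"
    and x: "(w, x) \<in> (color_edges i (A - {v}))\<^sup>*"
    and y: "y \<in> A - {v}" "(w, y) \<notin> (color_edges i (A - {v}))\<^sup>*"
  shows "col x y = j"
proof -
  let ?E = "(color_edges i (A - {v}))\<^sup>*"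
  have g: "gallai_on (A - {v})" using assms(1) gallai_on_subset by blast
  obtain y' where y': "(y, y') \<in> ?E" "col v y' = i" "y' \<in> A - {v}"
    using component_of_deleted_vertex assms(2,3) y(1) by metis
  have ny': "(w, y') \<notin> ?E"
    using y'(1) y(2) color_reach_sym rtrancl_trans by metis
  then have "w \<noteq> y'" by auto
  have "col w y' \<noteq> i"
    using ny' w y' \<open>w \<noteq> y'\<close> by (auto simp: color_edges_def)
  then have "col w y' = j"
    using gallai_onD[OF assms(1), of v w y'] w y' \<open>w \<noteq> y'\<close> assms(2,4) by auto
  moreover have "col y w = col y' w"
    using component_homogeneous[OF g y(1) w(1) y'(1)] y(2) color_reach_sym by metis
  moreover have "col w y = col x y"
    using component_homogeneous[OF g w(1) y(1) x y(2)] .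
  ultimately show ?thesis using col_sym by metis
qed

text \<open>
  If deleting \<open>v\<close> disconnects color \<open>i\<close>, then a component containing a \<open>j\<close>-neighbor of \<open>v\<close> sends
  only color \<open>j\<close> to the other components. This cannot hold for two colors \<open>j\<close> at once.
\<close>

lemma color_connected_delete:
  assumes "gallai_on A" "v \<in> A" "w \<in> A" "w \<noteq> v" "i \<noteq> j" "i \<noteq> l" "j \<noteq> l"
    and "color_connected i A" "color_connected j A" "color_connected l A"
  shows "color_connected i (A - {v})"
proof (rule ccontr)
  let ?E = "(color_edges i (A - {v}))\<^sup>*"
  assume "\<not> ?thesis"
  then obtain x y where xy: "x \<in> A - {v}" "y \<in> A - {v}" "(x, y) \<notin> ?E"
    by (auto simp: color_connected_def)
  obtain p where p: "p \<in> A - {v}" "col v p = j"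
    using color_connected_edge[OF assms(9,2,3,4)] by blast
  obtain q where q: "q \<in> A - {v}" "col v q = l"
    using color_connected_edge[OF assms(10,2,3,4)] by blast
  have P: "col a b = j" if "(p, a) \<in> ?E" "b \<in> A - {v}" "(p, b) \<notin> ?E" for a b
    using deleted_component_color[OF assms(1,2,8) _ p that] assms(5) by simp
  have Q: "col a b = l" if "(q, a) \<in> ?E" "b \<in> A - {v}" "(q, b) \<notin> ?E" for a b
    using deleted_component_color[OF assms(1,2,8) _ q that] assms(6) by simp
  show False
  \<comment> \<open>If \<open>p\<close> and \<open>q\<close> share a component, an edge from it to a
    vertex \<open>b\<close> outside would have both colors \<open>j\<close> and \<open>l\<close>;
    otherwise the edge \<open>p q\<close> would.\<close>
  proof (cases "(p, q) \<in> ?E")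
    case True
    obtain b where b: "b \<in> A - {v}" "(p, b) \<notin> ?E"
      using xy color_reach_sym rtrancl_trans by metis
    then have "(q, b) \<notin> ?E" using True rtrancl_trans by metis
    then show False using P[of p b] Q[of q b] P[of q b] b True assms(7) by auto
  next
    case False
    then have "(q, p) \<notin> ?E" using color_reach_sym by metis
    then show False using P[of p q] Q[of q p] False p q assms(7) col_sym by auto
  qed
qed

text \<open>Deleting a vertex keeps all three colors connected, so the set can be shrunk to two
  vertices, whose single edge cannot have several colors.\<close>

lemma not_three_connected_colors:
  assumes "finite A" "card A \<ge> 2" "gallai_on A" "i \<noteq> j" "i \<noteq> l" "j \<noteq> l"
    and "color_connected i A" "color_connected j A" "color_connected l A"
  shows False
  using assms(1-3,7-9)
proof (induction "card A" arbitrary: A rule: less_induct)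
  case less
  then obtain v w where vw: "v \<in> A" "w \<in> A" "w \<noteq> v"
    by (metis card_le_Suc0_iff_eq not_less_eq_eq numeral_2_eq_2)
  show False
  proof (cases "card A = 2")
    case True
    then have A: "A = {v, w}"
      using card_subset_eq[of A "{v, w}"] vw less.prems(1) by auto
    have "col v w = i" "col v w = j"
      using color_connected_edge[OF less.prems(4) vw]
        color_connected_edge[OF less.prems(5) vw] A
      by (metis empty_iff insert_iff)+
    then show False using assms(4) by simp
  next
    case False
    have c: "card (A - {v}) < card A" "card (A - {v}) \<ge> 2"
      using False less.prems(1,2) vw by (auto simp: card_Diff_singleton_if)
    show False
    proof (rule less.hyps[OF c(1) _ c(2)])
      show "finite (A - {v})" using less.prems by simp
      show "gallai_on (A - {v})" using less.prems gallai_on_subset by blast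
      show "color_connected i (A - {v})"
        using color_connected_delete[of A v w i j l] less.prems vw assms(4-6) by metis
      show "color_connected j (A - {v})"
        using color_connected_delete[of A v w j i l] less.prems vw assms(4-6) by metis
      show "color_connected l (A - {v})"
        using color_connected_delete[of A v w l i j] less.prems vw assms(4-6) by metis
    qed
  qed
qed

section \<open>Gallai partitions\<close>

text \<open>A partition is encoded by a map \<open>p\<close> that sends each vertex to a representative of its part.\<close>

definition homogeneous :: "'a set \<Rightarrow> ('a \<Rightarrow> 'a) \<Rightarrow> bool" where
  "homogeneous A p \<longleftrightarrow> p ` A \<subseteq> A \<and> (\<forall>x\<in>A. p (p x) = p x) \<and>
     (\<forall>x\<in>A. \<forall>y\<in>A. p x \<noteq> p y \<longrightarrow> col x y = col (p x) (p y))"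

text \<open>Parts whose representatives lie in one component of color \<open>i\<close> are merged.
  As color \<open>i\<close> is disconnected on \<open>S\<close>, at least two parts remain; as it
  occurs on an edge of \<open>S\<close>, their number drops.\<close>

lemma coarsen_homogeneous:
  assumes "finite A" "gallai_on A" "homogeneous A p"
    and S: "S = p ` A" and nc: "\<not> color_connected i S"
    and e: "x0 \<in> S" "y0 \<in> S" "x0 \<noteq> y0" "col x0 y0 = i"
  obtains p' where "homogeneous A p'" "card (p' ` A) \<ge> 2" "card (p' ` A) < card (p ` A)"
proof -
  let ?E = "(color_edges i S)\<^sup>*"
  \<comment> \<open>The predicate under \<open>SOME\<close> is the same for all vertices of a
    component, so the choice depends on the component alone.\<close>
  define \<rho> where "\<rho> x = (SOME y. (x, y) \<in> ?E)" for x
  have rho: "(x, \<rho> x) \<in> ?E" for x unfolding \<rho>_def by (rule someI[of _ x]) simp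
  have rho_eq: "\<rho> x = \<rho> y \<longleftrightarrow> (x, y) \<in> ?E" for x y
  proof
    assume "\<rho> x = \<rho> y"
    then show "(x, y) \<in> ?E" using rho color_reach_sym rtrancl_trans by metis
  next
    assume "(x, y) \<in> ?E"
    then have "(x, z) \<in> ?E \<longleftrightarrow> (y, z) \<in> ?E" for z
      using color_reach_sym rtrancl_trans by metis
    then show "\<rho> x = \<rho> y" unfolding \<rho>_def by simp
  qed
  have SA: "S \<subseteq> A" and pS: "\<And>x. x \<in> S \<Longrightarrow> p x = x" and fin: "finite S"
    using assms(1,3) S by (auto simp: homogeneous_def)
  have gS: "gallai_on S" using assms(2) SA gallai_on_subset by blast
  have rS: "\<rho> x \<in> S" if "x \<in> S" for x using rho that color_reach_in by metis
  have im: "(\<lambda>x. \<rho> (p x)) ` A = \<rho> ` S" using S by auto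
  have "homogeneous A (\<lambda>x. \<rho> (p x))"
    unfolding homogeneous_def
  proof (intro conjI ballI impI)
    show "(\<lambda>x. \<rho> (p x)) ` A \<subseteq> A" using im rS SA by auto
    fix x assume x: "x \<in> A"
    then have px: "p x \<in> S" using S by auto
    then show "\<rho> (p (\<rho> (p x))) = \<rho> (p x)"
      using pS rS rho_eq rho color_reach_sym by metis
    fix y assume y: "y \<in> A" and ne: "\<rho> (p x) \<noteq> \<rho> (p y)"
    have py: "p y \<in> S" using y S by auto
    have "p x \<noteq> p y" using ne by auto
    then have "col x y = col (p x) (p y)" using assms(3) x y by (auto simp: homogeneous_def)
    also have "\<dots> = col (\<rho> (p x)) (p y)"
      using component_homogeneous[OF gS px py rho] ne rho_eq by blast
    also have "\<dots> = col (p y) (\<rho> (p x))" by (rule col_sym)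
    also have "\<dots> = col (\<rho> (p y)) (\<rho> (p x))"
      by (rule component_homogeneous[OF gS py rS[OF px] rho])
        (use ne rho_eq rho rtrancl_trans color_reach_sym in metis)
    also have "\<dots> = col (\<rho> (p x)) (\<rho> (p y))" by (rule col_sym)
    finally show "col x y = col (\<rho> (p x)) (\<rho> (p y))" .
  qed
  moreover have "card (\<rho> ` S) \<ge> 2"
  proof -
    obtain a b where "a \<in> S" "b \<in> S" "\<rho> a \<noteq> \<rho> b"
      using nc rho_eq by (auto simp: color_connected_def)
    then have "{\<rho> a, \<rho> b} \<subseteq> \<rho> ` S" "card {\<rho> a, \<rho> b} = 2" by auto
    then show ?thesis using fin by (metis card_mono finite_imageI)
  qed
  moreover have "card (\<rho> ` S) < card S"
  proof -
    have "(x0, y0) \<in> ?E" using e by (auto simp: color_edges_def)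
    then have "\<not> inj_on \<rho> S" using e rho_eq by (auto simp: inj_on_def)
    then show ?thesis using fin card_image_le eq_card_imp_inj_on le_neq_implies_less by metis
  qed
  ultimately show thesis using that im S by metis
qed

text \<open>If three colors occur between the representatives, one of them is disconnected there and
  the partition can be coarsened along it. The number of parts decreases, so this stops.\<close>

lemma homogeneous_two_colors:
  assumes "finite A" "gallai_on A" "homogeneous A p" "card (p ` A) \<ge> 2"
  shows "\<exists>p a b. homogeneous A p \<and> card (p ` A) \<ge> 2 \<and>
    (\<forall>x\<in>A. \<forall>y\<in>A. p x \<noteq> p y \<longrightarrow> col x y \<in> {a, b})"
  using assms(3,4)
proof (induction "card (p ` A)" arbitrary: p rule: less_induct)
  case less
  define S where "S = p ` A"
  define U where "U = {col x y | x y. x \<in> S \<and> y \<in> S \<and> x \<noteq> y}"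
  have SA: "S \<subseteq> A" "finite S" using less.prems assms(1) by (auto simp: homogeneous_def S_def)
  have inU: "col x y \<in> U" if "x \<in> A" "y \<in> A" "p x \<noteq> p y" for x y
  proof -
    have "col x y = col (p x) (p y)" using less.prems(1) that by (auto simp: homogeneous_def)
    then show ?thesis unfolding U_def S_def using that by blast
  qed
  show ?case
  proof (cases "\<exists>i j l. i \<in> U \<and> j \<in> U \<and> l \<in> U \<and> i \<noteq> j \<and> i \<noteq> l \<and> j \<noteq> l")
    case True
    then obtain i j l where ijl: "i \<in> U" "j \<in> U" "l \<in> U" "i \<noteq> j" "i \<noteq> l" "j \<noteq> l" by blast
    have "gallai_on S" using SA assms(2) gallai_on_subset by blast
    then have "\<not> color_connected i S \<or> \<not> color_connected j S \<or> \<not> color_connected l S"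
      using not_three_connected_colors[of S i j l] SA ijl less.prems(2) S_def by auto
    then obtain d where d: "d \<in> U" "\<not> color_connected d S" using ijl by blast
    then obtain x0 y0 where "x0 \<in> S" "y0 \<in> S" "x0 \<noteq> y0" "col x0 y0 = d"
      unfolding U_def by blast
    then obtain p' where "homogeneous A p'" "card (p' ` A) \<ge> 2" "card (p' ` A) < card (p ` A)"
      using coarsen_homogeneous[OF assms(1,2) less.prems(1) S_def d(2)] by blast
    then show ?thesis using less.hyps[of p'] by simp
  next
    case False
    then obtain a b where "U \<subseteq> {a, b}" by (metis insertCI subsetI)
    then have "\<forall>x\<in>A. \<forall>y\<in>A. p x \<noteq> p y \<longrightarrow> col x y \<in> {a, b}" using inU by blast
    then show ?thesis using less.prems by metis
  qed
qed

theorem gallai_partition: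
  assumes "finite A" "gallai_on A" "card A \<ge> 2"
  obtains p a b where "homogeneous A p" "card (p ` A) \<ge> 2"
    "\<And>x y. x \<in> A \<Longrightarrow> y \<in> A \<Longrightarrow> p x \<noteq> p y \<Longrightarrow> col x y = a \<or> col x y = b"
proof -
  \<comment> \<open>Coarsening starts from the partition into singletons.\<close>
  have "homogeneous A (\<lambda>x. x)" by (auto simp: homogeneous_def)
  from homogeneous_two_colors[OF assms(1,2) this] assms(3)
  obtain p a b where p: "homogeneous A p" "card (p ` A) \<ge> 2"
    and "\<forall>x\<in>A. \<forall>y\<in>A. p x \<noteq> p y \<longrightarrow> col x y \<in> {a, b}" by auto
  then show thesis using that[OF p, of a b] by blast
qed

section \<open>Monochromatic paths and vertices of low degree\<close>

definition mono_path :: "nat \<Rightarrow> 'a set \<Rightarrow> 'a list \<Rightarrow> bool" where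
  "mono_path i S xs \<longleftrightarrow> distinct xs \<and> set xs \<subseteq> S \<and>
     (\<forall>j. Suc j < length xs \<longrightarrow> col (xs ! j) (xs ! Suc j) = i)"

definition mono_cycle :: "nat \<Rightarrow> 'a set \<Rightarrow> 'a list \<Rightarrow> bool" where
  "mono_cycle i S xs \<longleftrightarrow> distinct xs \<and> set xs \<subseteq> S \<and>
     (\<forall>j < length xs. col (xs ! j) (xs ! (Suc j mod length xs)) = i)"

definition color_nbrs :: "nat \<Rightarrow> 'a set \<Rightarrow> 'a \<Rightarrow> 'a set" where
  "color_nbrs i S x = {y \<in> S. y \<noteq> x \<and> col x y = i}"

lemma mono_path_Cons:
  assumes "mono_path i S xs" "y \<in> S" "y \<notin> set xs" "xs \<noteq> [] \<Longrightarrow> col y (hd xs) = i"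
  shows "mono_path i S (y # xs)"
  unfolding mono_path_def
proof (intro conjI allI impI)
  show "distinct (y # xs)" "set (y # xs) \<subseteq> S" using assms by (auto simp: mono_path_def)
  fix j assume "Suc j < length (y # xs)"
  then show "col ((y # xs) ! j) ((y # xs) ! Suc j) = i"
    using assms by (cases j) (auto simp: mono_path_def hd_conv_nth)
qed

text \<open>A path is extended greedily at its head: with fewer than \<open>m\<close> vertices, at
  most \<open>m - 2\<close> of them differ from the head, too few to exhaust its neighbors.\<close>

lemma path_of_min_degree:
  assumes "finite S" "S \<noteq> {}" "\<And>x. x \<in> S \<Longrightarrow> card (color_nbrs i S x) \<ge> m - 1"
  shows "\<exists>xs. length xs = m \<and> mono_path i S xs"
proof -
  have "j \<le> m \<Longrightarrow> \<exists>xs. length xs = j \<and> mono_path i S xs" for j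
  proof (induction j)
    case 0
    show ?case by (rule exI[of _ "[]"]) (simp add: mono_path_def)
  next
    case (Suc j)
    then obtain xs where xs: "length xs = j" "mono_path i S xs" by auto
    show ?case
    proof (cases xs)
      case Nil
      obtain x where "x \<in> S" using assms(2) by auto
      then have "mono_path i S [x]" by (simp add: mono_path_def)
      then show ?thesis using xs Nil by (intro exI[of _ "[x]"]) auto
    next
      case (Cons x ys)
      have "x \<in> S" "x \<notin> set ys" "distinct ys" using xs Cons by (auto simp: mono_path_def)
      have "card (set ys) < card (color_nbrs i S x)"
        using assms(3)[OF \<open>x \<in> S\<close>] Suc.prems xs(1) Cons \<open>distinct ys\<close>
        by (simp add: distinct_card)
      then have "\<not> color_nbrs i S x \<subseteq> set ys" by (meson List.finite_set card_mono not_le)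
      then obtain y where "y \<in> S" "y \<noteq> x" "col x y = i" "y \<notin> set ys"
        by (auto simp: color_nbrs_def)
      then have "mono_path i S (y # xs)"
        using mono_path_Cons[OF xs(2)] Cons col_sym by auto
      then show ?thesis using xs(1) by (intro exI[of _ "y # xs"]) auto
    qed
  qed
  then show ?thesis by auto
qed

definition path_free :: "nat \<Rightarrow> nat \<Rightarrow> 'a set \<Rightarrow> bool" where
  "path_free m i S \<longleftrightarrow> \<not> (\<exists>xs. length xs = m \<and> mono_path i S xs)"

lemma path_free_subset: "path_free m i S \<Longrightarrow> V \<subseteq> S \<Longrightarrow> path_free m i V"
  unfolding path_free_def mono_path_def by blast

lemma path_free_low_degree:
  assumes "path_free m i S" "finite S" "S \<noteq> {}"
  obtains v where "v \<in> S" "card (color_nbrs i S v) < m - 1"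
  using path_of_min_degree[OF assms(2,3), where i=i and m=m] assms(1)
  unfolding path_free_def by (meson not_le)

text \<open>If both sides had at least \<open>m\<close> vertices, every vertex of the union would
  have degree at least \<open>m\<close> in color \<open>i\<close>, so no vertex of low degree could
  exist.\<close>

lemma path_free_joined:
  assumes "path_free m i (V \<union> T)" "finite V" "finite T" "V \<inter> T = {}" "card V \<ge> m" "m > 0"
    and join: "\<And>x y. x \<in> V \<Longrightarrow> y \<in> T \<Longrightarrow> col x y = i"
  shows "card T < m"
proof (rule ccontr)
  assume "\<not> card T < m"
  have ne: "V \<union> T \<noteq> {}" using assms(5,6) by auto
  have fin: "finite (V \<union> T)" using assms by simp
  obtain v where v: "v \<in> V \<union> T" "card (color_nbrs i (V \<union> T) v) < m - 1"
    using path_free_low_degree[OF assms(1) fin ne] .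
  have fn: "finite (color_nbrs i (V \<union> T) v)" using fin by (auto simp: color_nbrs_def)
  have "T \<subseteq> color_nbrs i (V \<union> T) v \<or> V \<subseteq> color_nbrs i (V \<union> T) v"
  proof (cases "v \<in> V")
    case True
    then show ?thesis using assms(4) join by (auto simp: color_nbrs_def)
  next
    case False
    then have "\<And>x. x \<in> V \<Longrightarrow> col v x = i" using v(1) join col_sym by (metis UnE)
    then show ?thesis using False by (auto simp: color_nbrs_def)
  qed
  then have "m \<le> card (color_nbrs i (V \<union> T) v)"
    using \<open>\<not> card T < m\<close> assms(5) card_mono[OF fn] by (meson le_trans not_le)
  then show False using v(2) by simp
qed

text \<open>Greedy choice: a vertex of degree at most \<open>m - 2\<close> in color \<open>i\<close>
  is put into \<open>I\<close>, and it and its neighbors, at most \<open>m - 1\<close> vertices, are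
  discarded.\<close>

lemma path_free_independent:
  assumes "path_free m i S" "finite S" "m \<ge> 2"
  shows "\<exists>I\<subseteq>S. card S \<le> (m - 1) * card I \<and> (\<forall>x\<in>I. \<forall>y\<in>I. x \<noteq> y \<longrightarrow> col x y \<noteq> i)"
  using assms(1,2)
proof (induction "card S" arbitrary: S rule: less_induct)
  case less
  show ?case
  proof (cases "S = {}")
    case True
    then show ?thesis by auto
  next
    case False
    then obtain v where v: "v \<in> S" "card (color_nbrs i S v) < m - 1"
      using path_free_low_degree less.prems by metis
    define S' where "S' = S - insert v (color_nbrs i S v)"
    have "S' \<subset> S" using v by (auto simp: S'_def)
    then have "card S' < card S" using less.prems by (simp add: psubset_card_mono)
    moreover have "path_free m i S'" using less.prems path_free_subset \<open>S' \<subset> S\<close> by blast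
    moreover have "finite S'" using less.prems by (simp add: S'_def)
    ultimately obtain I where I: "I \<subseteq> S'" "card S' \<le> (m - 1) * card I"
      "\<forall>x\<in>I. \<forall>y\<in>I. x \<noteq> y \<longrightarrow> col x y \<noteq> i"
      using less.hyps by metis
    have "finite (color_nbrs i S v)" using less.prems by (auto simp: color_nbrs_def)
    moreover have "v \<notin> color_nbrs i S v" by (auto simp: color_nbrs_def)
    ultimately have "card (insert v (color_nbrs i S v)) \<le> m - 1" using v by simp
    moreover have "S = S' \<union> insert v (color_nbrs i S v)" using v by (auto simp: S'_def color_nbrs_def)
    ultimately have "card S \<le> card S' + (m - 1)"
      using card_Un_le[of S' "insert v (color_nbrs i S v)"] by simp
    moreover have "finite I" using I(1) \<open>finite S'\<close> by (rule finite_subset)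
    moreover have "v \<notin> I" using I(1) by (auto simp: S'_def)
    ultimately have "card S \<le> (m - 1) * card (insert v I)" using I(2) by simp
    moreover have "col v x \<noteq> i" if "x \<in> I" for x
      using that I(1) by (auto simp: S'_def color_nbrs_def)
    then have "\<forall>x\<in>insert v I. \<forall>y\<in>insert v I. x \<noteq> y \<longrightarrow> col x y \<noteq> i"
      using I(3) col_sym by (metis insert_iff)
    moreover have "insert v I \<subseteq> S" using I v by (auto simp: S'_def)
    ultimately show ?thesis by blast
  qed
qed

text \<open>Inside a set \<open>I\<close> independent in color \<open>b\<close>, all edges between
  parts have color \<open>a\<close>. A vertex of \<open>I\<close> with low degree in color
  \<open>a\<close> therefore has nearly all of \<open>I\<close> in its own part, which is
  small.\<close>

lemma two_path_free_bound:
  assumes "finite A" "path_free m a A" "path_free m b A" "m \<ge> 4"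
    and cross: "\<And>x y. x \<in> A \<Longrightarrow> y \<in> A \<Longrightarrow> p x \<noteq> p y \<Longrightarrow> col x y = a \<or> col x y = b"
    and small: "\<And>v. v \<in> A \<Longrightarrow> card {x \<in> A. p x = p v} < m"
  shows "card A \<le> 4 * (m - 2)\<^sup>2"
proof (cases "A = {}")
  case False
  obtain I where I: "I \<subseteq> A" "card A \<le> (m - 1) * card I"
    "\<forall>x\<in>I. \<forall>y\<in>I. x \<noteq> y \<longrightarrow> col x y \<noteq> b"
    using path_free_independent[OF assms(3,1)] assms(4) by auto
  have fin: "finite I" using I(1) assms(1) finite_subset by blast
  have "I \<noteq> {}" using False assms(1) I(2) by auto
  then obtain v where v: "v \<in> I" "card (color_nbrs a I v) < m - 1"
    using path_free_low_degree[of m a I] path_free_subset[OF assms(2) I(1)] fin by metis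
  have "I \<subseteq> {x \<in> A. p x = p v} \<union> color_nbrs a I v"
  proof
    fix x assume "x \<in> I"
    moreover have "col v x = a" if "p x \<noteq> p v"
    proof -
      have "v \<noteq> x" using that by auto
      then have "col v x \<noteq> b" using I(3) v(1) \<open>x \<in> I\<close> by blast
      then show ?thesis using cross[of v x] that v(1) \<open>x \<in> I\<close> I(1) by auto
    qed
    ultimately show "x \<in> {x \<in> A. p x = p v} \<union> color_nbrs a I v"
      using I(1) by (auto simp: color_nbrs_def)
  qed
  moreover have "finite ({x \<in> A. p x = p v} \<union> color_nbrs a I v)"
    using assms(1) fin by (auto simp: color_nbrs_def)
  ultimately have "card I \<le> card ({x \<in> A. p x = p v} \<union> color_nbrs a I v)"
    using card_mono by blast
  also have "\<dots> \<le> card {x \<in> A. p x = p v} + card (color_nbrs a I v)"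
    by (rule card_Un_le)
  finally have "card I \<le> card {x \<in> A. p x = p v} + card (color_nbrs a I v)" .
  moreover have "card {x \<in> A. p x = p v} < m" using small v I by auto
  ultimately have "card I \<le> 2 * m - 3" using v(2) by linarith
  then have "card A \<le> (m - 1) * (2 * m - 3)"
    using I(2) by (meson le_trans mult_le_mono2)
  \<comment> \<open>For \<open>m = 4\<close> this reads 15 \<le> 16; it fails for
    \<open>m = 3\<close>.\<close>
  also have "\<dots> \<le> 4 * (m - 2)\<^sup>2"
  proof -
    obtain d where "m = d + 4" using assms(4) by (metis add.commute le_iff_add)
    then show ?thesis by (simp add: power2_eq_square algebra_simps)
  qed
  finally show ?thesis .
qed simp

section \<open>Forbidden configurations and how they are lowered\<close>

text \<open>As \<open>m = n - 2\<close>, the length \<open>Suc m\<close> is the \<open>n - 1\<close>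
  of the rim of the wheel and of the cycle. The sets \<open>T\<close> collect vertices for path
  colors only, and there paths may also run through \<open>T\<close>.\<close>

fun avoids :: "nat \<Rightarrow> nat \<Rightarrow> target \<Rightarrow> 'a set \<Rightarrow> 'a set \<Rightarrow> bool" where
  "avoids m i Wheel T A \<longleftrightarrow> T = {} \<and>
     \<not> (\<exists>h xs. h \<in> A \<and> h \<notin> set xs \<and> length xs = Suc m \<and> mono_cycle i A xs \<and>
       (\<forall>x\<in>set xs. col h x = i))"
| "avoids m i Cycle T A \<longleftrightarrow> T = {} \<and> \<not> (\<exists>xs. length xs = Suc m \<and> mono_cycle i A xs)"
| "avoids m i Path T A \<longleftrightarrow> finite T \<and> A \<inter> T = {} \<and> (\<forall>x\<in>A. \<forall>y\<in>T. col x y = i) \<and>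
     path_free m i (A \<union> T)"

definition admissible :: "nat set \<Rightarrow> nat \<Rightarrow> (nat \<Rightarrow> target) \<Rightarrow> (nat \<Rightarrow> 'a set) \<Rightarrow> 'a set \<Rightarrow> bool" where
  "admissible K m \<sigma> T A \<longleftrightarrow> finite A \<and> gallai_on A \<and>
     (\<forall>x\<in>A. \<forall>y\<in>A. x \<noteq> y \<longrightarrow> col x y \<in> K) \<and> (\<forall>i\<in>K. avoids m i (\<sigma> i) (T i) A)"

lemma mono_cycle_mono: "mono_cycle i V xs \<Longrightarrow> V \<subseteq> A \<Longrightarrow> mono_cycle i A xs"
  by (auto simp: mono_cycle_def)

lemma avoids_subset:
  assumes "avoids m i s T A" "V \<subseteq> A"
  shows "avoids m i s T V"
proof (cases s)
  case Path
  then show ?thesis using assms path_free_subset[of m i "A \<union> T" "V \<union> T"] by auto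
next
  case Wheel
  show ?thesis
    using assms(1,2) mono_cycle_mono[OF _ assms(2)] unfolding Wheel avoids.simps by blast
next
  case Cycle
  show ?thesis
    using assms(1) mono_cycle_mono[OF _ assms(2)] unfolding Cycle avoids.simps by blast
qed

lemma mono_cycle_Cons:
  assumes "mono_path i V xs" "V \<subseteq> A" "v \<in> A" "v \<notin> V" "xs \<noteq> []"
    and join: "\<And>x. x \<in> V \<Longrightarrow> col v x = i"
  shows "mono_cycle i A (v # xs)"
  unfolding mono_cycle_def
proof (intro conjI allI impI)
  have xs: "distinct xs" "set xs \<subseteq> V"
    "\<And>j. Suc j < length xs \<Longrightarrow> col (xs ! j) (xs ! Suc j) = i"
    using assms(1) by (auto simp: mono_path_def)
  show "distinct (v # xs)" "set (v # xs) \<subseteq> A" using xs assms by auto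
  have ends: "col v (xs ! j) = i" "col (xs ! j) v = i" if "j < length xs" for j
    using that xs(2) join col_sym nth_mem[OF that] by (metis subsetD)+
  fix j assume j: "j < length (v # xs)"
  show "col ((v # xs) ! j) ((v # xs) ! (Suc j mod length (v # xs))) = i"
  proof (cases j)
    case 0
    then show ?thesis using ends(1)[of 0] assms(5) by simp
  next
    case (Suc l)
    show ?thesis
    proof (cases "Suc l = length xs")
      \<comment> \<open>Here \<open>xs ! l\<close> is the last vertex of the path, and the index
        after it wraps around to 0, the position of \<open>v\<close>.\<close>
      case True
      have "(v # xs) ! j = xs ! l" using Suc by simp
      moreover have "Suc j mod length (v # xs) = 0" using Suc True by simp
      ultimately show ?thesis using True ends(2)[of l] by simp
    next
      case False
      then show ?thesis using Suc j xs(3)[of l] by simp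
    qed
  qed
qed

text \<open>The vertex \<open>v\<close> serves as the hub over a cycle in \<open>V\<close>, or
  closes a path in \<open>V\<close> to a cycle.\<close>

lemma avoids_lower:
  assumes "avoids m i s T A" "s \<noteq> Path" "V \<subseteq> A" "v \<in> A" "v \<notin> V" "m > 0"
    and join: "\<And>x. x \<in> V \<Longrightarrow> col v x = i"
  shows "avoids m i (lower s) T V"
proof (cases s)
  case Wheel
  have "\<not> mono_cycle i V xs" if "length xs = Suc m" for xs
  proof
    assume c: "mono_cycle i V xs"
    then have "set xs \<subseteq> V" by (simp add: mono_cycle_def)
    then have "v \<notin> set xs" "\<forall>x\<in>set xs. col v x = i" using assms(5) join by auto
    then show False
      using assms(1,4) Wheel that mono_cycle_mono[OF c assms(3)] by auto
  qed
  then show ?thesis using Wheel assms(1) by auto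
next
  case Cycle
  have "\<not> mono_path i V xs" if "length xs = m" for xs
  proof
    assume "mono_path i V xs"
    then have "mono_cycle i A (v # xs)"
      using mono_cycle_Cons assms(3-6) join that by (metis length_greater_0_conv)
    then show False using assms(1) Cycle that by (metis avoids.simps(2) length_Cons)
  qed
  then show ?thesis using Cycle assms(1) by (auto simp: path_free_def)
qed (use assms in simp)

text \<open>Since \<open>V\<close> and \<open>R\<close> lie in \<open>A\<close>, a path in
  \<open>V \<union> (T \<union> R)\<close> is one in \<open>A \<union> T\<close>. The size bound is
  \<open>path_free_joined\<close>.\<close>

lemma avoids_path_move:
  assumes "avoids m i Path T A" "V \<subseteq> A" "R \<subseteq> A" "V \<inter> R = {}" "finite A"
    and "\<forall>x\<in>V. \<forall>y\<in>R. col x y = i"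
  shows "avoids m i Path (T \<union> R) V"
    and "card (T \<union> R) = card T + card R"
    and "card V \<ge> m \<Longrightarrow> m > 0 \<Longrightarrow> card (T \<union> R) < m"
proof -
  have R: "finite R" "T \<inter> R = {}" using assms by (auto intro: finite_subset)
  show a: "avoids m i Path (T \<union> R) V"
    using assms R path_free_subset[of m i "A \<union> T" "V \<union> (T \<union> R)"] by auto
  show "card (T \<union> R) = card T + card R" using R assms(1) by (simp add: card_Un_disjoint)
  show "card (T \<union> R) < m" if "card V \<ge> m" "m > 0"
    using path_free_joined[of m i V "T \<union> R"] a that finite_subset[OF assms(2,5)] by auto
qed

declare avoids.simps [simp del]

lemma admissible_subset: "admissible K m \<sigma> T A \<Longrightarrow> V \<subseteq> A \<Longrightarrow> admissible K m \<sigma> T V"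
  unfolding admissible_def using avoids_subset[of m _ _ _ A V] gallai_on_subset[of A V]
  by (blast intro: finite_subset)

lemma admissible_lower:
  assumes "admissible K m \<sigma> T A" "\<sigma> i \<noteq> Path" "V \<subseteq> A" "v \<in> A" "v \<notin> V" "m > 0"
    and "\<And>x. x \<in> V \<Longrightarrow> col v x = i"
  shows "admissible K m (\<sigma>(i := lower (\<sigma> i))) T V"
proof -
  have "admissible K m \<sigma> T V" using assms admissible_subset by blast
  moreover have "avoids m i (lower (\<sigma> i)) (T i) V" if "i \<in> K"
    using avoids_lower[of m i "\<sigma> i" "T i" A V v] assms that by (auto simp: admissible_def)
  ultimately show ?thesis by (auto simp: admissible_def)
qed

section \<open>The induction on the vertex set\<close>

text \<open>For a path color the larger side \<open>X\<close> has at least \<open>m\<close>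
  vertices, so \<open>Y\<close> can move into \<open>T i\<close> and the slack pays for it exactly.
  Otherwise color \<open>i\<close> is lowered on \<open>X\<close>, and twice the bound for
  \<open>X\<close> suffices.\<close>

lemma two_part_step:
  assumes adm: "admissible K m \<sigma> T A" and "finite K" "i \<in> K" "m \<ge> 4"
    and IH: "\<forall>V \<sigma>' T'. V \<subset> A \<longrightarrow> admissible K m \<sigma>' T' V \<longrightarrow>
      card V \<le> target_bound K m \<sigma>' + slack K m T'"
    and XY: "A = X \<union> Y" "X \<inter> Y = {}" "X \<noteq> {}" "Y \<noteq> {}" "card Y \<le> card X"
    and join: "\<forall>x\<in>X. \<forall>y\<in>Y. col x y = i"
    and big: "2 * m \<le> card A"
  shows "card A \<le> target_bound K m \<sigma> + slack K m T"
proof -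
  have fin: "finite A" "finite X" "finite Y" using adm XY by (auto simp: admissible_def)
  have cA: "card A = card X + card Y" using XY fin by (simp add: card_Un_disjoint)
  have sub: "X \<subset> A" using XY by auto
  show ?thesis
  proof (cases "\<sigma> i = Path")
    case True
    have av: "avoids m i Path (T i) A" using adm True assms(3) by (metis admissible_def)
    have XA: "X \<subseteq> A" and YA: "Y \<subseteq> A" using XY by auto
    note move = avoids_path_move[OF av XA YA XY(2) fin(1) join]
    have "card X \<ge> m" using big cA XY(5) by simp
    then have lt: "card (T i \<union> Y) < m" using move(3) assms(4) by simp
    have "admissible K m \<sigma> (T(i := T i \<union> Y)) X"
      using admissible_subset[OF adm XA] move(1) True by (auto simp: admissible_def)
    then have "card X \<le> target_bound K m \<sigma> + slack K m (T(i := T i \<union> Y))"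
      using IH sub by blast
    moreover have "slack K m (T(i := T i \<union> Y)) + card Y = slack K m T"
      using slack_update[OF assms(2,3), where T = T] move(2) lt by simp
    ultimately show ?thesis using cA by simp
  next
    case False
    obtain y where y: "y \<in> Y" using XY by auto
    have "admissible K m (\<sigma>(i := lower (\<sigma> i))) T X"
      by (rule admissible_lower[OF adm False, of X y])
        (use y XY(1,2) assms(4) join col_sym[of y] in auto)
    then have "card X \<le> target_bound K m (\<sigma>(i := lower (\<sigma> i))) + slack K m T"
      using IH sub by blast
    moreover have "3 * target_bound K m (\<sigma>(i := lower (\<sigma> i))) \<le> target_bound K m \<sigma>"
      using target_bound_lower assms(2,3) False by blast
    moreover have "3 * slack K m T + 3 * (m - 2) \<le> target_bound K m \<sigma>"
      using target_bound_one_nonpath assms(2-4) False by blast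
    ultimately show ?thesis using cA XY(5) by linarith
  qed
qed

theorem admissible_card:
  assumes "admissible K m \<sigma> T A" "finite K" "m \<ge> 4"
  shows "card A \<le> target_bound K m \<sigma> + slack K m T"
  using assms(1)
proof (induction "card A" arbitrary: A \<sigma> T rule: less_induct)
  case less
  note adm = less.prems
  have fin: "finite A" and gal: "gallai_on A"
    and inK: "\<And>x y. x \<in> A \<Longrightarrow> y \<in> A \<Longrightarrow> x \<noteq> y \<Longrightarrow> col x y \<in> K"
    using adm by (auto simp: admissible_def)
  have IH: "\<forall>V \<sigma>' T'. V \<subset> A \<longrightarrow> admissible K m \<sigma>' T' V \<longrightarrow>
      card V \<le> target_bound K m \<sigma>' + slack K m T'"
    using less.hyps psubset_card_mono[OF fin] by blast
  show ?case
  proof (rule ccontr)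
    assume contra: "\<not> ?case"
    \<comment> \<open>This gives two vertices in a counterexample, as the Gallai partition
      requires.\<close>
    have "target_bound K m \<sigma> \<ge> 1"
    proof -
      have "(\<Prod>i\<in>K. weight (\<sigma> i)) > 0"
        using weight_ge_2 by (intro prod_pos) (metis not_less_eq_eq not_numeral_le_zero gr0I)
      then show ?thesis using assms(3) by (simp add: target_bound_def Suc_le_eq)
    qed
    then have "card A \<ge> 2" using contra by simp
    then obtain p a b where p: "homogeneous A p" "card (p ` A) \<ge> 2"
      and ab: "\<And>x y. x \<in> A \<Longrightarrow> y \<in> A \<Longrightarrow> p x \<noteq> p y \<Longrightarrow> col x y = a \<or> col x y = b"
      using gallai_partition[OF fin gal] by metis
    define V where "V v = {x \<in> A. p x = p v}" for v
    define R where "R v = {x \<in> A. p x \<noteq> p v \<and> col v x = a}" for v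
    \<comment> \<open>Stated as color other than \<open>a\<close>, so that \<open>V v\<close>,
      \<open>R v\<close> and \<open>B v\<close> partition \<open>A\<close> whatever \<open>a\<close>
      and \<open>b\<close> are; \<open>joinB\<close> recovers the color \<open>b\<close>.\<close>
    define B where "B v = {x \<in> A. p x \<noteq> p v \<and> col v x \<noteq> a}" for v
    have hom: "col x y = col v y" if "v \<in> A" "x \<in> V v" "y \<in> A" "p y \<noteq> p v" for v x y
    proof -
      have "col x y = col (p x) (p y)" "col v y = col (p v) (p y)"
        using p(1) that by (auto simp: homogeneous_def V_def)
      then show ?thesis using that by (simp add: V_def)
    qed
    have joinR: "\<forall>x\<in>V v. \<forall>y\<in>R v. col x y = a" if "v \<in> A" for v
      using hom[OF that] by (auto simp: R_def)
    have joinB: "\<forall>x\<in>V v. \<forall>y\<in>B v. col x y = b" if "v \<in> A" for v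
    proof (intro ballI)
      fix x y assume "x \<in> V v" and y: "y \<in> B v"
      then have "col x y = col v y" using hom[OF that] by (auto simp: B_def)
      then show "col x y = b" using ab[OF that, of y] y by (auto simp: B_def)
    qed
    have part: "A = V v \<union> R v \<union> B v" "V v \<inter> R v = {}" "V v \<inter> B v = {}" "R v \<inter> B v = {}" for v
      by (auto simp: V_def R_def B_def)
    have cA: "card A = card (V v) + card (R v) + card (B v)" for v
    proof -
      have "finite (V v)" "finite (R v)" "finite (B v)" using part(1)[of v] fin by auto
      then have "card (V v \<union> R v \<union> B v) = card (V v) + card (R v) + card (B v)"
        using part(2-4)[of v] by (simp add: card_Un_disjoint Int_Un_distrib2)
      then show ?thesis using part(1)[of v] by simp
    qed
    \<comment> \<open>An edge shows that \<open>K\<close> is nonempty, and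
      \<open>(m - 2)\<^sup>2 \<ge> m\<close> for \<open>m \<ge> 4\<close>.\<close>
    have big: "2 * m \<le> card A"
    proof -
      obtain x y where "x \<in> A" "y \<in> A" "x \<noteq> y"
        using \<open>card A \<ge> 2\<close> fin by (metis card_le_Suc0_iff_eq not_less_eq_eq numeral_2_eq_2)
      then have "2 * (m - 2)\<^sup>2 \<le> target_bound K m \<sigma>"
        using target_bound_ge_one[OF assms(2) inK] by blast
      moreover obtain d where "m = d + 4" using assms(3) by (metis add.commute le_iff_add)
      then have "m \<le> (m - 2)\<^sup>2" by (simp add: power2_eq_square algebra_simps)
      ultimately show ?thesis using contra by simp
    qed
    have two_part: False
      if XY: "A = X \<union> Y" "X \<inter> Y = {}" "X \<noteq> {}" "Y \<noteq> {}"
        and join: "\<forall>x\<in>X. \<forall>y\<in>Y. col x y = i" for X Y i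
    proof -
      obtain x y where "x \<in> X" "y \<in> Y" using XY by blast
      then have "i \<in> K" using XY join inK[of x y] by auto
      note step = two_part_step[OF adm assms(2) \<open>i \<in> K\<close> assms(3) IH _ _ _ _ _ _ big]
      have "A = Y \<union> X" "Y \<inter> X = {}" using XY by auto
      moreover have "\<forall>x\<in>Y. \<forall>y\<in>X. col x y = i" using join col_sym by metis
      ultimately show False
        using step[of X Y] step[of Y X] XY join contra by (meson nat_le_linear)
    qed
    \<comment> \<open>If \<open>R v\<close> or \<open>B v\<close> were empty, \<open>A\<close> would
      split into two sides joined in a single color, which \<open>two_part\<close> excludes.\<close>
    have ne: "R v \<noteq> {}" "B v \<noteq> {}" "V v \<subset> A" if v: "v \<in> A" for v
    proof -
      have vV: "v \<in> V v" using v by (auto simp: V_def)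
      have "V v \<noteq> A"
      proof
        assume "V v = A"
        then have "p ` A \<subseteq> {p v}" by (auto simp: V_def)
        then have "card (p ` A) \<le> card {p v}" by (intro card_mono) auto
        then show False using p(2) by simp
      qed
      then show "V v \<subset> A" by (auto simp: V_def)
      have RB: "R v \<noteq> {} \<or> B v \<noteq> {}" using \<open>V v \<noteq> A\<close> part(1)[of v] by auto
      show "R v \<noteq> {}"
      proof
        assume "R v = {}"
        then show False
          using two_part[of "V v" "B v" b] part(1,3)[of v] vV RB joinB[OF v] by blast
      qed
      show "B v \<noteq> {}"
      proof
        assume "B v = {}"
        then show False
          using two_part[of "V v" "R v" a] part(1,2)[of v] vV RB joinR[OF v] by blast
      qed
    qed
    obtain v0 where v0: "v0 \<in> A" using \<open>card A \<ge> 2\<close> by fastforce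
    have abK: "a \<in> K" "b \<in> K" "a \<noteq> b"
    proof -
      obtain x y where "x \<in> R v0" "y \<in> B v0" using ne v0 by blast
      moreover from this have "v0 \<noteq> x" "v0 \<noteq> y" by (auto simp: R_def B_def)
      ultimately show "a \<in> K" "b \<in> K" "a \<noteq> b"
        using inK[of v0 x] inK[of v0 y] ab[of v0 y] v0 by (auto simp: R_def B_def)
    qed
    \<comment> \<open>Stated for a generic \<open>C\<close> to cover both \<open>R\<close> with
      color \<open>a\<close> and \<open>B\<close> with color \<open>b\<close>. A vertex of either
      side serves as the apex that lowers the color on the other side.\<close>
    have nonpath: "admissible K m (\<sigma>(c := lower (\<sigma> c))) T (V v)"
      "card (C v) \<le> target_bound K m (\<sigma>(c := lower (\<sigma> c))) + slack K m T"
      if "\<sigma> c \<noteq> Path" "v \<in> A" "C v \<subset> A" "C v \<noteq> {}" "V v \<inter> C v = {}"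
        and jC: "\<forall>x\<in>V v. \<forall>y\<in>C v. col x y = c" for c C v
    proof -
      have vV: "v \<in> V v" using that by (auto simp: V_def)
      from that(4) obtain w where w: "w \<in> C v" by auto
      show "admissible K m (\<sigma>(c := lower (\<sigma> c))) T (V v)"
      proof (rule admissible_lower[OF adm that(1), of "V v" w])
        show "V v \<subseteq> A" "w \<in> A" "w \<notin> V v" "m > 0" using w that assms(3) by (auto simp: V_def)
        show "col w x = c" if "x \<in> V v" for x using jC that w col_sym by metis
      qed
      have "admissible K m (\<sigma>(c := lower (\<sigma> c))) T (C v)"
        by (rule admissible_lower[OF adm that(1), of "C v" v]) (use that vV assms(3) in auto)
      then show "card (C v) \<le> target_bound K m (\<sigma>(c := lower (\<sigma> c))) + slack K m T"
        using IH that by blast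
    qed
    \<comment> \<open>The part is chosen around a vertex \<open>v\<close> of low degree in the path
      color \<open>d\<close>, so that \<open>D v\<close> has at most \<open>m - 2\<close> vertices,
      while \<open>V v\<close> and \<open>C v\<close> each cost at most a third of the bound plus
      one slack.\<close>
    have mixed: False
      if cd: "\<sigma> c \<noteq> Path" "\<sigma> d = Path" "c \<in> K" "d \<in> K"
        and C: "\<And>v. v \<in> A \<Longrightarrow> C v \<subset> A" "\<And>v. v \<in> A \<Longrightarrow> C v \<noteq> {}" "\<And>v. V v \<inter> C v = {}"
        and jC: "\<And>v. v \<in> A \<Longrightarrow> \<forall>x\<in>V v. \<forall>y\<in>C v. col x y = c"
        and D: "\<And>v. v \<in> A \<Longrightarrow> D v \<subseteq> color_nbrs d A v"
        and card: "\<And>v. card A = card (V v) + card (C v) + card (D v)" for c d C D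
    proof -
      have "path_free m d (A \<union> T d)"
        using adm cd unfolding admissible_def by (metis avoids.simps(3))
      then have "path_free m d A" by (rule path_free_subset) simp
      then obtain v where v: "v \<in> A" "card (color_nbrs d A v) < m - 1"
        using path_free_low_degree[of m d A] fin v0 by blast
      note np = nonpath[of c v C, OF cd(1) v(1) C(1)[OF v(1)] C(2)[OF v(1)] C(3) jC[OF v(1)]]
      have "card (D v) \<le> card (color_nbrs d A v)"
        using D[OF v(1)] fin by (intro card_mono) (auto simp: color_nbrs_def)
      then have "card (D v) \<le> m - 2" using v(2) by linarith
      moreover have "card (C v) \<le> target_bound K m (\<sigma>(c := lower (\<sigma> c))) + slack K m T"
        using np(2) .
      moreover have "card (V v) \<le> target_bound K m (\<sigma>(c := lower (\<sigma> c))) + slack K m T"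
        using np(1) IH ne(3)[OF v(1)] by blast
      moreover have "3 * target_bound K m (\<sigma>(c := lower (\<sigma> c))) \<le> target_bound K m \<sigma>"
        using target_bound_lower assms(2) cd by blast
      moreover have "3 * slack K m T + 3 * (m - 2) \<le> target_bound K m \<sigma>"
        using target_bound_one_nonpath assms(2,3) cd by blast
      ultimately show False using contra card[of v] by linarith
    qed
    have Rsub: "R v \<subset> A" "R v \<subseteq> color_nbrs a A v" if "v \<in> A" for v
      using that by (auto simp: R_def color_nbrs_def)
    have Bsub: "B v \<subset> A" "B v \<subseteq> color_nbrs b A v" if "v \<in> A" for v
      using that joinB[OF that] by (auto simp: B_def V_def color_nbrs_def)
    consider "\<sigma> a \<noteq> Path" "\<sigma> b \<noteq> Path" | "\<sigma> a \<noteq> Path" "\<sigma> b = Path"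
      | "\<sigma> a = Path" "\<sigma> b \<noteq> Path" | "\<sigma> a = Path" "\<sigma> b = Path" by blast
    then show False
    proof cases
      case 1
      let ?a = "\<sigma>(a := lower (\<sigma> a))" and ?b = "\<sigma>(b := lower (\<sigma> b))"
      let ?ab = "?a(b := lower (?a b))"
      note na = nonpath[of a v0 R, OF 1(1) v0 Rsub(1)[OF v0] ne(1)[OF v0] part(2) joinR[OF v0]]
      note nb = nonpath[of b v0 B, OF 1(2) v0 Bsub(1)[OF v0] ne(2)[OF v0] part(3) joinB[OF v0]]
      \<comment> \<open>Both colors are lowered on \<open>V v0\<close>, by apexes in
        \<open>R v0\<close> and in \<open>B v0\<close>.\<close>
      have "admissible K m ?ab T (V v0)"
        using na(1) nb(1) abK(3) by (auto simp: admissible_def)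
      then have "card (V v0) \<le> target_bound K m ?ab + slack K m T"
        using IH ne(3)[OF v0] by blast
      moreover have "3 * target_bound K m ?ab \<le> target_bound K m ?a"
        using target_bound_lower[of K b ?a] assms(2) abK 1 by simp
      moreover have "3 * target_bound K m ?a \<le> target_bound K m \<sigma>"
        "3 * target_bound K m ?b \<le> target_bound K m \<sigma>"
        using target_bound_lower assms(2) abK 1 by blast+
      moreover have "9 * slack K m T \<le> target_bound K m \<sigma>"
        using target_bound_two_nonpath[OF assms(2) abK 1 assms(3)] .
      ultimately show False using na(2) nb(2) contra cA[of v0] by linarith
    next
      case 2
      show False
        by (rule mixed[of a b R B, OF 2 abK(1,2) Rsub(1) ne(1) part(2) joinR Bsub(2) cA])
    next
      case 3
      have "card A = card (V v) + card (B v) + card (R v)" for v using cA[of v] by simp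
      note mixed[of b a B R, OF 3(2,1) abK(2,1) Bsub(1) ne(2) part(3) joinB Rsub(2) this]
      then show False .
    next
      case 4
      have av: "avoids m a Path (T a) A" "avoids m b Path (T b) A"
        using adm abK 4 by (metis admissible_def)+
      show False
      proof (cases "\<exists>v\<in>A. card (V v) \<ge> m")
        case True
        then obtain v where v: "v \<in> A" "card (V v) \<ge> m" by blast
        have VA: "V v \<subseteq> A" and RA: "R v \<subseteq> A" and BA: "B v \<subseteq> A"
          by (auto simp: V_def R_def B_def)
        note ma = avoids_path_move[OF av(1) VA RA part(2) fin joinR[OF v(1)]]
        note mb = avoids_path_move[OF av(2) VA BA part(3) fin joinB[OF v(1)]]
        let ?T = "T(a := T a \<union> R v)"
        let ?T' = "?T(b := ?T b \<union> B v)"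
        \<comment> \<open>The targets stay the same; the slack falls by
          \<open>card (R v) + card (B v)\<close>, exactly the vertices left out of
          \<open>V v\<close>.\<close>
        have "admissible K m \<sigma> ?T' (V v)"
          using admissible_subset[OF adm VA] ma(1) mb(1) 4 abK(3)
          by (simp add: admissible_def)
        then have "card (V v) \<le> target_bound K m \<sigma> + slack K m ?T'"
          using IH ne(3)[OF v(1)] by blast
        moreover have "slack K m ?T' + card (B v) = slack K m ?T"
          using mb(3) v(2) assms(3) abK mb(2)
          by (intro slack_update[OF assms(2) abK(2)]) auto
        moreover have "slack K m ?T + card (R v) = slack K m T"
          using ma(3) v(2) assms(3) ma(2)
          by (intro slack_update[OF assms(2) abK(1)]) auto
        ultimately show False using contra cA[of v] by linarith
      next
        case False
        have "path_free m a A" "path_free m b A"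
          using av by (auto simp: avoids.simps intro: path_free_subset)
        moreover have "card {x \<in> A. p x = p v} < m" if "v \<in> A" for v
          using False that by (auto simp: V_def not_le)
        ultimately have "card A \<le> 4 * (m - 2)\<^sup>2"
          using two_path_free_bound[OF fin _ _ assms(3) ab] by blast
        then show False
          using target_bound_ge_two[OF assms(2) abK, of m \<sigma>] contra by linarith
      qed
    qed
  qed
qed

end

section \<open>Translation to copies of graphs, and the final bound\<close>

lemma path_copy:
  assumes "symmetric_coloring.mono_path (\<lambda>x y. c {x, y}) i {..<N} xs"
  shows "has_mono_copy N c (path_graph (length xs)) i"
proof -
  interpret symmetric_coloring "\<lambda>x y. c {x, y}" by unfold_locales (simp add: insert_commute)
  have "distinct xs" "set xs \<subseteq> {..<N}" "\<And>j. Suc j < length xs \<Longrightarrow> c {xs ! j, xs ! Suc j} = i"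
    using assms by (auto simp: mono_path_def)
  then show ?thesis
    unfolding has_mono_copy_def path_graph_def complete_graph_def
    by (intro exI[of _ "(!) xs"]) (auto simp: inj_on_nth intro: nth_mem)
qed

lemma cycle_copy:
  assumes "symmetric_coloring.mono_cycle (\<lambda>x y. c {x, y}) i {..<N} xs"
  shows "has_mono_copy N c (cycle_graph (length xs)) i"
proof -
  interpret symmetric_coloring "\<lambda>x y. c {x, y}" by unfold_locales (simp add: insert_commute)
  have "distinct xs" "set xs \<subseteq> {..<N}"
    "\<And>j. j < length xs \<Longrightarrow> c {xs ! j, xs ! (Suc j mod length xs)} = i"
    using assms by (auto simp: mono_cycle_def)
  then show ?thesis
    unfolding has_mono_copy_def cycle_graph_def complete_graph_def
    by (intro exI[of _ "(!) xs"]) (auto simp: inj_on_nth intro: nth_mem)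
qed

lemma wheel_copy:
  assumes "symmetric_coloring.mono_cycle (\<lambda>x y. c {x, y}) i {..<N} xs"
    and "h < N" "h \<notin> set xs" "\<And>x. x \<in> set xs \<Longrightarrow> c {h, x} = i"
  shows "has_mono_copy N c (wheel_graph (Suc (length xs))) i"
proof -
  interpret symmetric_coloring "\<lambda>x y. c {x, y}" by unfold_locales (simp add: insert_commute)
  have xs: "distinct xs" "set xs \<subseteq> {..<N}"
    "\<And>j. j < length xs \<Longrightarrow> c {xs ! j, xs ! (Suc j mod length xs)} = i"
    using assms(1) by (auto simp: mono_cycle_def)
  define f where "f = case_sum (\<lambda>_::nat. h) ((!) xs)"
  have f: "f (Inl u) = h" "f (Inr j) = xs ! j" for u j by (simp_all add: f_def)
  have verts: "fst (wheel_graph (Suc (length xs))) = {Inl 0} \<union> Inr ` {..<length xs}"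
    by (auto simp: wheel_graph_def graph_join_def complete_graph_def cycle_graph_def Plus_def)
  \<comment> \<open>The hub is a \<open>complete_graph 1\<close>, which contributes no edges, so
    only rim edges and spokes remain.\<close>
  have "[{..<1::nat}]\<^bsup>2\<^esup> = {}" by (simp add: nsets_eq_empty_iff)
  then have edges: "(\<exists>j<length xs. e = {Inr j, Inr (Suc j mod length xs)}) \<or>
      (\<exists>j<length xs. e = {Inl 0, Inr j})"
    if "e \<in> snd (wheel_graph (Suc (length xs)))" for e
    using that
    by (auto simp: wheel_graph_def graph_join_def complete_graph_def cycle_graph_def)
  have "inj_on f (fst (wheel_graph (Suc (length xs))))"
    unfolding verts using xs(1) assms(3) by (auto simp: inj_on_def f nth_eq_iff_index_eq)
  moreover have "f ` fst (wheel_graph (Suc (length xs))) \<subseteq> {..<N}"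
    unfolding verts using xs(2) assms(2) nth_mem by (fastforce simp: f)
  moreover have "c (f ` e) = i" if "e \<in> snd (wheel_graph (Suc (length xs)))" for e
    using edges[OF that] xs(3) assms(4) by (auto simp: f)
  ultimately show ?thesis
    unfolding has_mono_copy_def by (auto simp: complete_graph_def)
qed

theorem theorem10:
  fixes k n r s t :: nat
  assumes "k \<ge> 1" and "n \<ge> 6" and "r + s + t = k"
  shows "gallai_ramsey_number k n r s t \<le> (n - 4)\<^sup>2 * 30 ^ r * 10 ^ s * 2 ^ t + k * (n - 1)"
proof -
  define N where "N = (n - 4)\<^sup>2 * 30 ^ r * 10 ^ s * 2 ^ t + k * (n - 1)"
  have "gr_property k n r s t N"
    unfolding gr_property_def
  proof (intro allI impI, rule ccontr)
    fix c
    assume col: "edge_coloring k N c"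
    assume "\<not> (has_rainbow_triangle N c \<or>
       (\<exists>i \<in> {1..r}. has_mono_copy N c (wheel_graph n) i) \<or>
       (\<exists>i \<in> {r + 1..r + s}. has_mono_copy N c (cycle_graph (n - 1)) i) \<or>
       (\<exists>i \<in> {r + s + 1..k}. has_mono_copy N c (path_graph (n - 2)) i))"
    then have rainbow: "\<not> has_rainbow_triangle N c"
      and wheel: "\<And>i. i \<in> {1..r} \<Longrightarrow> \<not> has_mono_copy N c (wheel_graph n) i"
      and cycle: "\<And>i. i \<in> {r + 1..r + s} \<Longrightarrow> \<not> has_mono_copy N c (cycle_graph (n - 1)) i"
      and path: "\<And>i. i \<in> {r + s + 1..k} \<Longrightarrow> \<not> has_mono_copy N c (path_graph (n - 2)) i"
      by blast+
    interpret symmetric_coloring "\<lambda>x y. c {x, y}" by unfold_locales (simp add: insert_commute)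
    define \<sigma> where "\<sigma> i = (if i \<le> r then Wheel else if i \<le> r + s then Cycle else Path)" for i
    have len: "Suc (Suc (n - 2)) = n" "Suc (n - 2) = n - 1" using assms(2) by auto
    have "gallai_on {..<N}"
      unfolding gallai_on_def
    proof (intro ballI impI, rule ccontr)
      fix x y z assume "x \<in> {..<N}" "y \<in> {..<N}" "z \<in> {..<N}" "x \<noteq> y" "y \<noteq> z" "x \<noteq> z"
        "\<not> (c {x, y} = c {y, z} \<or> c {y, z} = c {x, z} \<or> c {x, y} = c {x, z})"
      then have "has_rainbow_triangle N c"
        unfolding has_rainbow_triangle_def complete_graph_def
        by (intro exI[of _ x] exI[of _ y] exI[of _ z]) auto
      then show False using rainbow by blast
    qed
    moreover have "c {x, y} \<in> {1..k}" if "x < N" "y < N" "x \<noteq> y" for x y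
      using col that by (auto simp: edge_coloring_def complete_graph_def nsets_def)
    moreover have "avoids (n - 2) i (\<sigma> i) {} {..<N}" if "i \<in> {1..k}" for i
    proof (cases "\<sigma> i")
      case Wheel
      then have "i \<in> {1..r}" using that by (auto simp: \<sigma>_def split: if_splits)
      then have "\<not> (h \<in> {..<N} \<and> h \<notin> set xs \<and> length xs = Suc (n - 2) \<and>
          mono_cycle i {..<N} xs \<and> (\<forall>x\<in>set xs. c {h, x} = i))" for h xs
        using wheel[of i] wheel_copy[of c i N xs h] len(1) by (metis lessThan_iff)
      then show ?thesis unfolding Wheel avoids.simps by blast
    next
      case Cycle
      then have "i \<in> {r + 1..r + s}" using that by (auto simp: \<sigma>_def split: if_splits)
      then show ?thesis
        using cycle[of i] cycle_copy[of c i N] len(2) unfolding Cycle avoids.simps by metis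
    next
      case Path
      then have "i \<in> {r + s + 1..k}" using that by (auto simp: \<sigma>_def split: if_splits)
      then have "path_free (n - 2) i {..<N}"
        using path[of i] path_copy[of c i N] unfolding path_free_def by metis
      then show ?thesis unfolding Path avoids.simps by simp
    qed
    ultimately have "admissible {1..k} (n - 2) \<sigma> (\<lambda>_. {}) {..<N}"
      by (auto simp: admissible_def)
    \<comment> \<open>With all sets \<open>T i\<close> empty at the start, the slack is
      \<open>k * (n - 2)\<close>.\<close>
    then have "card {..<N} \<le> target_bound {1..k} (n - 2) \<sigma> + slack {1..k} (n - 2) (\<lambda>_. {} :: nat set)"
      using assms(2) by (intro admissible_card) auto
    moreover have "slack {1..k} (n - 2) (\<lambda>_. {} :: nat set) = k * (n - 2)"
      by (simp add: slack_def)
    moreover have "target_bound {1..k} (n - 2) \<sigma> = (n - 4)\<^sup>2 * 30 ^ r * 10 ^ s * 2 ^ t"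
    proof -
      have K: "{1..k} = {1..r} \<union> {r + 1..r + s} \<union> {r + s + 1..r + s + t}" using assms(3) by auto
      have "(\<Prod>i\<in>{1..k}. weight (\<sigma> i)) =
        (\<Prod>i\<in>{1..r}. weight (\<sigma> i)) * (\<Prod>i\<in>{r + 1..r + s}. weight (\<sigma> i)) *
        (\<Prod>i\<in>{r + s + 1..r + s + t}. weight (\<sigma> i))"
        unfolding K by (subst prod.union_disjoint; auto)+
      also have "\<dots> = 30 ^ r * 10 ^ s * 2 ^ t" by (simp add: \<sigma>_def)
      finally show ?thesis by (simp add: target_bound_def mult.assoc)
    qed
    \<comment> \<open>Strict because \<open>k \<ge> 1\<close>: a coloring without the required
      subgraphs has fewer than \<open>N\<close> vertices.\<close>
    moreover have "k * (n - 2) < k * (n - 1)" using assms(1,2) by simp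
    ultimately show False by (simp add: N_def)
  qed
  then show ?thesis
    unfolding gallai_ramsey_number_def N_def by (rule Least_le)
qed

end
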